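(* Let $(X,\alpha,m)$ be a dynamical system over $\mathbb{Z}$ and let $f\in L^2(X,m)$. Then the diffraction measure $\omega^f$ of $f$ equals the spectral measure $\varrho^f$ of $f$, i.e. $\omega^f=\varrho^f$ as measures on $\mathbb{T}$.
   Context: $\mathbb{T}=\{z\in\mathbb{C}:|z|=1\}$. A dynamical system $(X,\alpha,m)$ over $\mathbb{Z}$ consists of a compact (Hausdorff) space $X$, a continuous action $\alpha:\mathbb{Z}\times X\to X$ and an $\alpha$-invariant (regular Borel) probability measure $m$ on $X$. $L^2(X,m)$ carries the inner product $\langle f,g\rangle=\int_X f\overline{g}\,dm$, and $U$ is the unitary operator $Uf=f\circ\alpha_{-1}$. $C_c(\mathbb{Z})$ is the space of finitely supported functions $\mathbb{Z}\to\mathbb{C}$; $1_n$ is the characteristic function of $\{n\}$; $(\varphi\ast\psi)(n)=\sum_k\varphi(n-k)\psi(k)$; $\widetilde{\varphi}(n)=\overline{\varphi(-n)}$; $(\beta_n\varphi)(k)=\varphi(k-n)$. A function $p:\mathbb{Z}\to\mathbb{C}$ is positive definite if $\sum_n p(n)(\varphi\ast\widetilde\varphi)(n)\ge 0$ for all $\varphi\in C_c(\mathbb{Z})$; by Bochner's theorem there is then a unique finite positive measure $\varrho$ on $\mathbb{T}$ with $p(n)=\int_{\mathbb{T}}z^n\,d\varrho(z)$ for all $n$. Spectral measure: for $f\in L^2(X,m)$, $\varrho^f$ is the unique measure on $\mathbb{T}$ with $\langle U^nf,f\rangle=\int_{\mathbb{T}}z^n\,d\varrho^f(z)$ for all $n\in\mathbb{Z}$.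 Diffraction: let $\mathcal{N}:C_c(\mathbb{Z})\to L^2(X,m)$ be linear and equivariant, i.e. $\mathcal{N}(\beta_n\varphi)=U^n\mathcal{N}(\varphi)$. Its autocorrelation is the unique function $\gamma$ on $\mathbb{Z}$ with $\sum_{n}\gamma(n)(\varphi\ast\widetilde\psi)(n)=\langle\mathcal{N}(\varphi),\mathcal{N}(\psi)\rangle$ for all $\varphi,\psi\in C_c(\mathbb{Z})$; it is positive definite, and the diffraction measure of $\mathcal{N}$ is the unique measure $\omega$ on $\mathbb{T}$ with $\gamma(n)=\int_{\mathbb{T}}z^n\,d\omega(z)$ for all $n$. For $f\in L^2(X,m)$ the map $\mathcal{N}^f(\varphi)=\sum_{n\in\mathbb{Z}}\varphi(n)U^nf$ is linear and equivariant; the diffraction measure of $\mathcal{N}^f$ is called the diffraction measure of $f$ and denoted $\omega^f$. *)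

theory Defs
  imports "HOL-Probability.Probability_Measure"
begin

(* Square integrable functions are handled through representatives: an element of L^2(m) is
   given by a measurable function, and equality in L^2(m) is equality almost everywhere. *)

definition square_integrable :: "'a measure \<Rightarrow> ('a \<Rightarrow> complex) set" where
  "square_integrable m =
    {f \<in> borel_measurable m. integrable m (\<lambda>x. (cmod (f x))\<^sup>2)}"

definition L2_inner :: "'a measure \<Rightarrow> ('a \<Rightarrow> complex) \<Rightarrow> ('a \<Rightarrow> complex) \<Rightarrow> complex" where
  "L2_inner m f g = (LINT x|m. f x * cnj (g x))"

definition regular_measure :: "'a::t2_space measure \<Rightarrow> bool" where
  "regular_measure m \<longleftrightarrow>
    (\<forall>A\<in>sets m.
      emeasure m A = (SUP K\<in>{K. compact K \<and> K \<subseteq> A}. emeasure m K) \<and>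
      emeasure m A = (INF V\<in>{V. open V \<and> A \<subseteq> V}. emeasure m V))"

locale dynamical_system = prob_space m
  for \<alpha> :: "int \<Rightarrow> 'a::t2_space \<Rightarrow> 'a" and m :: "'a measure" +
  assumes compact_UNIV: "compact (UNIV :: 'a set)"
    and action_zero: "\<alpha> 0 x = x"
    and action_add: "\<alpha> (n + k) x = \<alpha> n (\<alpha> k x)"
    and action_continuous: "continuous_on UNIV (\<lambda>(n, x). \<alpha> n x)"
    and sets_borel: "sets m = sets borel"
    and regular: "regular_measure m"
    and invariant: "distr m m (\<alpha> n) = m"

definition koopman :: "(int \<Rightarrow> 'a \<Rightarrow> 'a) \<Rightarrow> ('a \<Rightarrow> complex) \<Rightarrow> ('a \<Rightarrow> complex)" where
  "koopman \<alpha> f = f \<circ> \<alpha> (-1)"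

(* For an action, koopman is a bijection on all functions, so "inv" is its inverse operator. *)

definition koopman_power ::
    "(int \<Rightarrow> 'a \<Rightarrow> 'a) \<Rightarrow> int \<Rightarrow> ('a \<Rightarrow> complex) \<Rightarrow> ('a \<Rightarrow> complex)" where
  "koopman_power \<alpha> n =
    (if 0 \<le> n then koopman \<alpha> ^^ nat n else inv (koopman \<alpha>) ^^ nat (- n))"

definition Cc :: "(int \<Rightarrow> complex) set" where
  "Cc = {\<phi>. finite {n. \<phi> n \<noteq> 0}}"

(* Sums over the integers with finitely supported summands are restricted to a support. *)

definition convolution ::
    "(int \<Rightarrow> complex) \<Rightarrow> (int \<Rightarrow> complex) \<Rightarrow> int \<Rightarrow> complex" where
  "convolution \<phi> \<psi> n = (\<Sum>k | \<psi> k \<noteq> 0. \<phi> (n - k) * \<psi> k)"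

definition involution :: "(int \<Rightarrow> complex) \<Rightarrow> int \<Rightarrow> complex" where
  "involution \<phi> n = cnj (\<phi> (- n))"

(* The measure that Bochner's theorem associates to a positive definite function p. *)

definition bochner_measure :: "(int \<Rightarrow> complex) \<Rightarrow> complex measure" where
  "bochner_measure p = (THE \<rho>.
    finite_measure \<rho> \<and> sets \<rho> = sets (restrict_space borel (sphere 0 1)) \<and>
    (\<forall>n. p n = (LINT z|\<rho>. z powi n)))"

definition spectral_measure ::
    "(int \<Rightarrow> 'a \<Rightarrow> 'a) \<Rightarrow> 'a measure \<Rightarrow> ('a \<Rightarrow> complex) \<Rightarrow> complex measure" where
  "spectral_measure \<alpha> m f = bochner_measure (\<lambda>n. L2_inner m (koopman_power \<alpha> n f) f)"

(* Meaningful for linear equivariant maps N from Cc to L^2(m). *)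

definition autocorrelation ::
    "'a measure \<Rightarrow> ((int \<Rightarrow> complex) \<Rightarrow> ('a \<Rightarrow> complex)) \<Rightarrow> int \<Rightarrow> complex" where
  "autocorrelation m N = (THE \<gamma>. \<forall>\<phi>\<in>Cc. \<forall>\<psi>\<in>Cc.
    (\<Sum>n | convolution \<phi> (involution \<psi>) n \<noteq> 0. \<gamma> n * convolution \<phi> (involution \<psi>) n)
      = L2_inner m (N \<phi>) (N \<psi>))"

definition diffraction_measure ::
    "'a measure \<Rightarrow> ((int \<Rightarrow> complex) \<Rightarrow> ('a \<Rightarrow> complex)) \<Rightarrow> complex measure" where
  "diffraction_measure m N = bochner_measure (autocorrelation m N)"

definition orbit_map ::
    "(int \<Rightarrow> 'a \<Rightarrow> 'a) \<Rightarrow> ('a \<Rightarrow> complex) \<Rightarrow> (int \<Rightarrow> complex) \<Rightarrow> ('a \<Rightarrow> complex)" where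
  "orbit_map \<alpha> f \<phi> = (\<lambda>x. \<Sum>n | \<phi> n \<noteq> 0. \<phi> n * koopman_power \<alpha> n f x)"

definition diffraction_measure_of ::
    "(int \<Rightarrow> 'a \<Rightarrow> 'a) \<Rightarrow> 'a measure \<Rightarrow> ('a \<Rightarrow> complex) \<Rightarrow> complex measure" where
  "diffraction_measure_of \<alpha> m f = diffraction_measure m (orbit_map \<alpha> f)"

end

theory Submission
  imports Defs
begin

text \<open>Both measures arise from Bochner's theorem, so it suffices to compare the two positive
  definite functions. By invariance of the measure, \<open>\<langle>U\<^sup>j f, U\<^sup>k f\<rangle>\<close> depends only on \<open>j - k\<close>, so
  expanding \<open>\<langle>\<N>\<^sup>f(\<phi>), \<N>\<^sup>f(\<psi>)\<rangle>\<close> sesquilinearly and collecting the terms with \<open>j - k = n\<close> shows that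
  \<open>n \<mapsto> \<langle>U\<^sup>n f, f\<rangle>\<close> has the defining property of the autocorrelation of \<open>\<N>\<^sup>f\<close>. Testing with
  \<open>\<phi> = 1\<^sub>n\<close> and \<open>\<psi> = 1\<^sub>0\<close> shows that no other function has it.\<close>

text \<open>The reflection \<open>k\<close> to \<open>- k\<close> maps the support of
  \<open>involution \<psi>\<close> onto that of \<open>\<psi>\<close>, so the sum can run over the
  latter.\<close>

lemma convolution_involution:
  "convolution \<phi> (involution \<psi>) n = (\<Sum>k | \<psi> k \<noteq> 0. \<phi> (n + k) * cnj (\<psi> k))"
  unfolding convolution_def
  by (rule sum.reindex_bij_witness[where i = uminus and j = uminus])
     (auto simp: involution_def)

text \<open>Grouping the pairs \<open>(j, k)\<close> by their difference \<open>n = j - k\<close>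
  gives the left side. The right side has the shape that a sesquilinear expansion of an inner
  product produces.\<close>

lemma sum_convolution_involution:
  assumes "\<phi> \<in> Cc" "\<psi> \<in> Cc"
  shows "(\<Sum>n | convolution \<phi> (involution \<psi>) n \<noteq> 0. \<gamma> n * convolution \<phi> (involution \<psi>) n)
    = (\<Sum>j | \<phi> j \<noteq> 0. \<Sum>k | \<psi> k \<noteq> 0. \<phi> j * cnj (\<psi> k) * \<gamma> (j - k))"
proof -
  let ?A = "{j. \<phi> j \<noteq> 0}" and ?B = "{k. \<psi> k \<noteq> 0}"
  let ?c = "convolution \<phi> (involution \<psi>)"
  \<comment> \<open>The support of \<open>?c\<close> may be smaller than \<open>F\<close>, since
    terms can cancel. The finite set \<open>F\<close> of all differences does not depend on
    \<open>k\<close>, which permits swapping the two sums.\<close>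
  define F where "F = (\<lambda>(j, k). j - k) ` (?A \<times> ?B)"
  have fin: "finite ?A" "finite ?B"
    using assms by (auto simp: Cc_def)
  then have "finite F"
    by (simp add: F_def)
  have "n \<in> F" if "?c n \<noteq> 0" for n
  proof -
    from that obtain k where "\<psi> k \<noteq> 0" "\<phi> (n + k) \<noteq> 0"
      unfolding convolution_involution by (auto elim!: sum.not_neutral_contains_not_neutral)
    then show ?thesis
      unfolding F_def by (intro image_eqI[of _ _ "(n + k, k)"]) auto
  qed
  with \<open>finite F\<close> have "(\<Sum>n | ?c n \<noteq> 0. \<gamma> n * ?c n) = (\<Sum>n\<in>F. \<gamma> n * ?c n)"
    by (intro sum.mono_neutral_left) auto
  also have "\<dots> = (\<Sum>n\<in>F. \<Sum>k\<in>?B. \<gamma> n * (\<phi> (n + k) * cnj (\<psi> k)))"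
    by (simp add: convolution_involution sum_distrib_left)
  also have "\<dots> = (\<Sum>k\<in>?B. \<Sum>n\<in>F. \<gamma> n * (\<phi> (n + k) * cnj (\<psi> k)))"
    by (rule sum.swap)
  also have "\<dots> = (\<Sum>k\<in>?B. \<Sum>j\<in>?A. \<phi> j * cnj (\<psi> k) * \<gamma> (j - k))"
  proof (rule sum.cong[OF refl])
    fix k assume k: "k \<in> ?B"
    \<comment> \<open>For fixed \<open>k\<close> the factor \<open>\<phi> (n + k)\<close> vanishes
      unless \<open>n = j - k\<close> for some \<open>j\<close> in \<open>?A\<close>; the
      substitution \<open>j = n + k\<close> then finishes the inner sum.\<close>
    have "(\<Sum>n\<in>F. \<gamma> n * (\<phi> (n + k) * cnj (\<psi> k)))
        = (\<Sum>n\<in>(\<lambda>j. j - k) ` ?A. \<gamma> n * (\<phi> (n + k) * cnj (\<psi> k)))"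
    proof (rule sum.mono_neutral_right[OF \<open>finite F\<close>])
      show "(\<lambda>j. j - k) ` ?A \<subseteq> F"
        using k by (auto simp: F_def intro!: image_eqI[of _ _ "(_, k)"])
      show "\<forall>n\<in>F - (\<lambda>j. j - k) ` ?A. \<gamma> n * (\<phi> (n + k) * cnj (\<psi> k)) = 0"
      proof
        fix n assume "n \<in> F - (\<lambda>j. j - k) ` ?A"
        then have "\<phi> (n + k) = 0"
          by (metis (mono_tags, lifting) DiffD2 add_diff_cancel_right' image_eqI mem_Collect_eq)
        then show "\<gamma> n * (\<phi> (n + k) * cnj (\<psi> k)) = 0"
          by simp
      qed
    qed
    also have "\<dots> = (\<Sum>j\<in>?A. \<phi> j * cnj (\<psi> k) * \<gamma> (j - k))"
      by (subst sum.reindex) (auto simp: inj_on_def mult_ac)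
    finally show "(\<Sum>n\<in>F. \<gamma> n * (\<phi> (n + k) * cnj (\<psi> k)))
        = (\<Sum>j\<in>?A. \<phi> j * cnj (\<psi> k) * \<gamma> (j - k))" .
  qed
  also have "\<dots> = (\<Sum>j\<in>?A. \<Sum>k\<in>?B. \<phi> j * cnj (\<psi> k) * \<gamma> (j - k))"
    by (rule sum.swap)
  finally show ?thesis .
qed

lemma autocorrelation_eqI:
  assumes "\<And>\<phi> \<psi>. \<phi> \<in> Cc \<Longrightarrow> \<psi> \<in> Cc \<Longrightarrow>
    (\<Sum>j | \<phi> j \<noteq> 0. \<Sum>k | \<psi> k \<noteq> 0. \<phi> j * cnj (\<psi> k) * \<gamma> (j - k)) = L2_inner m (N \<phi>) (N \<psi>)"
  shows "autocorrelation m N = \<gamma>"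
  unfolding autocorrelation_def
proof (rule the_equality)
  show "\<forall>\<phi>\<in>Cc. \<forall>\<psi>\<in>Cc.
    (\<Sum>n | convolution \<phi> (involution \<psi>) n \<noteq> 0. \<gamma> n * convolution \<phi> (involution \<psi>) n)
      = L2_inner m (N \<phi>) (N \<psi>)"
    using assms by (simp add: sum_convolution_involution)
next
  fix \<gamma>' :: "int \<Rightarrow> complex"
  assume \<gamma>': "\<forall>\<phi>\<in>Cc. \<forall>\<psi>\<in>Cc.
    (\<Sum>n | convolution \<phi> (involution \<psi>) n \<noteq> 0. \<gamma>' n * convolution \<phi> (involution \<psi>) n)
      = L2_inner m (N \<phi>) (N \<psi>)"
  show "\<gamma>' = \<gamma>"
  proof
    fix n
    \<comment> \<open>\<open>\<delta> i\<close> is the characteristic function of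
      \<open>{i}\<close>. The pair \<open>\<delta> n\<close>, \<open>\<delta> 0\<close> leaves only
      the term at \<open>n - 0\<close>, so the defining property fixes the value at
      \<open>n\<close>.\<close>
    define \<delta> :: "int \<Rightarrow> int \<Rightarrow> complex" where "\<delta> i k = (if k = i then 1 else 0)" for i k
    have supp: "{k. \<delta> i k \<noteq> 0} = {i}" for i
      by (auto simp: \<delta>_def)
    then have Cc: "\<delta> i \<in> Cc" for i
      by (simp add: Cc_def)
    have sum: "(\<Sum>j | \<delta> n j \<noteq> 0. \<Sum>k | \<delta> 0 k \<noteq> 0. \<delta> n j * cnj (\<delta> 0 k) * g (j - k)) = g n"
      for g :: "int \<Rightarrow> complex"
      unfolding supp by (simp add: \<delta>_def)
    have "\<gamma>' n = L2_inner m (N (\<delta> n)) (N (\<delta> 0))"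
      using \<gamma>' Cc sum[of \<gamma>'] by (simp add: sum_convolution_involution)
    also have "\<dots> = \<gamma> n"
      using assms[OF Cc Cc, of n 0] sum[of \<gamma>] by simp
    finally show "\<gamma>' n = \<gamma> n" .
  qed
qed

lemma borel_measurable_cnj [measurable]: "cnj \<in> borel_measurable borel"
  by (intro borel_measurable_continuous_onI continuous_intros)

text \<open>The pointwise bound \<open>a * b \<le> a\<^sup>2 + b\<^sup>2\<close> supplies an
  integrable majorant.\<close>

lemma integrable_mult_cnj:
  assumes "f \<in> square_integrable m" "g \<in> square_integrable m"
  shows "integrable m (\<lambda>x. f x * cnj (g x))"
proof (rule Bochner_Integration.integrable_bound)
  show "integrable m (\<lambda>x. (cmod (f x))\<^sup>2 + (cmod (g x))\<^sup>2)"
    using assms by (auto simp: square_integrable_def)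
  have [measurable]: "f \<in> borel_measurable m" "g \<in> borel_measurable m"
    using assms by (auto simp: square_integrable_def)
  show "(\<lambda>x. f x * cnj (g x)) \<in> borel_measurable m"
    by measurable
  have "a * b \<le> a\<^sup>2 + b\<^sup>2" if "0 \<le> a" "0 \<le> b" for a b :: real
    using sum_squares_bound[of a b] mult_nonneg_nonneg[OF that] by linarith
  then show "AE x in m. norm (f x * cnj (g x)) \<le> norm ((cmod (f x))\<^sup>2 + (cmod (g x))\<^sup>2)"
    by (auto simp: norm_mult)
qed

lemma L2_inner_sum:
  assumes "\<And>j. j \<in> A \<Longrightarrow> f j \<in> square_integrable m"
    and "\<And>k. k \<in> B \<Longrightarrow> g k \<in> square_integrable m"
  shows "L2_inner m (\<lambda>x. \<Sum>j\<in>A. a j * f j x) (\<lambda>x. \<Sum>k\<in>B. b k * g k x)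
    = (\<Sum>j\<in>A. \<Sum>k\<in>B. a j * cnj (b k) * L2_inner m (f j) (g k))"
proof -
  have int: "integrable m (\<lambda>x. a j * cnj (b k) * (f j x * cnj (g k x)))"
    if "j \<in> A" "k \<in> B" for j k
    using assms that by (intro integrable_mult_right integrable_mult_cnj) auto
  have "L2_inner m (\<lambda>x. \<Sum>j\<in>A. a j * f j x) (\<lambda>x. \<Sum>k\<in>B. b k * g k x)
      = (LINT x|m. (\<Sum>j\<in>A. \<Sum>k\<in>B. a j * cnj (b k) * (f j x * cnj (g k x))))"
    unfolding L2_inner_def by (simp add: sum_product mult_ac)
  also have "\<dots> = (\<Sum>j\<in>A. \<Sum>k\<in>B. (LINT x|m. a j * cnj (b k) * (f j x * cnj (g k x))))"
    using int by (simp add: Bochner_Integration.integral_sum)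
  finally show ?thesis
    by (simp add: L2_inner_def)
qed

context dynamical_system
begin

text \<open>Replaces the case distinction on the sign of \<open>n\<close> by one formula, to which
  the action law applies directly.\<close>

lemma koopman_power_eq: "koopman_power \<alpha> n f = f \<circ> \<alpha> (- n)"
proof -
  have zero: "\<alpha> 0 = id"
    by (simp add: fun_eq_iff action_zero)
  have inv: "inv (koopman \<alpha>) = (\<lambda>g. g \<circ> \<alpha> 1)"
    by (rule inv_unique_comp) (simp_all add: fun_eq_iff koopman_def flip: action_add, simp_all add: action_zero)
  \<comment> \<open>Used with \<open>i = - 1\<close>, \<open>k = nat n\<close> for
    \<open>0 \<le> n\<close>, and with \<open>i = 1\<close>, \<open>k = nat (- n)\<close> otherwise;
    \<open>int k * i\<close> is \<open>- n\<close> in both cases.\<close>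
  have pow: "((\<lambda>g. g \<circ> \<alpha> i) ^^ k) f = f \<circ> \<alpha> (int k * i)" for i k
    by (induction k) (simp_all add: zero fun_eq_iff algebra_simps flip: action_add)
  have "koopman \<alpha> = (\<lambda>g. g \<circ> \<alpha> (- 1))"
    by (simp add: fun_eq_iff koopman_def)
  with pow inv show ?thesis
    by (simp add: koopman_power_def)
qed

lemma action_measurable [measurable]: "\<alpha> n \<in> measurable m m"
proof -
  have "continuous_on UNIV (\<lambda>x. \<alpha> n x)"
    using continuous_on_compose2[OF action_continuous, of UNIV "\<lambda>x. (n, x)"]
    by (simp add: continuous_intros)
  then have "\<alpha> n \<in> borel_measurable borel"
    by (intro borel_measurable_continuous_onI)
  then show ?thesis
    using measurable_cong_sets[OF sets_borel sets_borel] by simp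
qed

lemma square_integrable_koopman_power:
  assumes "f \<in> square_integrable m"
  shows "koopman_power \<alpha> n f \<in> square_integrable m"
proof -
  have [measurable]: "f \<in> borel_measurable m" and int: "integrable m (\<lambda>x. (cmod (f x))\<^sup>2)"
    using assms by (auto simp: square_integrable_def)
  have "integrable (distr m m (\<alpha> (- n))) (\<lambda>x. (cmod (f x))\<^sup>2)"
    using int by (simp only: invariant)
  then have "integrable m (\<lambda>x. (cmod (f (\<alpha> (- n) x)))\<^sup>2)"
    by (subst (asm) integrable_distr_eq) simp_all
  then show ?thesis
    unfolding koopman_power_eq square_integrable_def comp_def by simp
qed

text \<open>This is unitarity of the Koopman operator: the invariant measure is replaced by its
  image under \<open>\<alpha> (- k)\<close>, and the change of variables turns \<open>k - j\<close>
  into \<open>(k - j) + (- k) = - j\<close>.\<close>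

lemma L2_inner_koopman_power:
  assumes "f \<in> square_integrable m"
  shows "L2_inner m (koopman_power \<alpha> j f) (koopman_power \<alpha> k f)
    = L2_inner m (koopman_power \<alpha> (j - k) f) f"
proof -
  have [measurable]: "f \<in> borel_measurable m"
    using assms by (auto simp: square_integrable_def)
  have "L2_inner m (koopman_power \<alpha> (j - k) f) f
      = (LINT x|distr m m (\<alpha> (- k)). f (\<alpha> (k - j) x) * cnj (f x))"
    by (simp add: L2_inner_def koopman_power_eq invariant)
  also have "\<dots> = (LINT x|m. f (\<alpha> (k - j) (\<alpha> (- k) x)) * cnj (f (\<alpha> (- k) x)))"
    by (subst integral_distr) simp_all
  finally show ?thesis
    by (simp add: L2_inner_def koopman_power_eq flip: action_add)
qed

lemma autocorrelation_orbit_map: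
  assumes "f \<in> square_integrable m"
  shows "autocorrelation m (orbit_map \<alpha> f) = (\<lambda>n. L2_inner m (koopman_power \<alpha> n f) f)"
  by (rule autocorrelation_eqI)
     (simp add: orbit_map_def L2_inner_sum square_integrable_koopman_power
        L2_inner_koopman_power assms)

end

theorem theorem1p3:
  fixes \<alpha> :: "int \<Rightarrow> 'a::t2_space \<Rightarrow> 'a"
    and m :: "'a measure"
    and f :: "'a \<Rightarrow> complex"
  assumes "dynamical_system \<alpha> m"
    and "f \<in> square_integrable m"
  shows "diffraction_measure_of \<alpha> m f = spectral_measure \<alpha> m f"
  using dynamical_system.autocorrelation_orbit_map[OF assms]
  by (simp add: diffraction_measure_of_def diffraction_measure_def spectral_measure_def)

end
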